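(* (Straight semi-continuous limit of the lattice modified Boussinesq equation A2.) Let $g_3(s)=s^3+\alpha_2s^2+\alpha_1s+\alpha_0$ with real coefficients, let $p,a\in\mathbb R$ with $p\neq a$, and let $v_{-1},v_0,v_1:\mathbb R\to\mathbb R$ be smooth and nowhere zero. For $q>0$ large put $\epsilon=1/q$, $P=g_3(p)-g_3(a)$, $Q=g_3(q)-g_3(a)$, fix $\xi\in\mathbb R$, and for $\nu,\mu\in\{-1,0,1\}$ set $$x_{\nu,\mu}=(p-a)^{-\nu}(q-a)^{-\mu}\,v_\nu(\xi+\epsilon\mu).$$ Let $$E=\left(\frac{P x_{0,0}-Qx_{-1,1}}{x_{-1,1}-x_{0,0}}\right)\frac{x_{0,1}}{x_{-1,0}}-\left(\frac{Px_{1,-1}-Qx_{0,0}}{x_{0,0}-x_{1,-1}}\right)\frac{x_{1,0}}{x_{0,-1}}-\left(\frac{x_{-1,-1}}{x_{0,-1}}-\frac{x_{-1,-1}}{x_{-1,0}}-\frac{x_{0,1}}{x_{1,1}}+\frac{x_{1,0}}{x_{1,1}}\right).$$ Then, as $q\to\infty$, $q\,E$ converges to $$\frac{v_1''}{v_1}+\frac{v_0''}{v_0}+\frac{v_{-1}''}{v_{-1}}-2\left(\frac{v_1'}{v_1}\right)^2-\left(\frac{v_0'}{v_0}\right)^2-\frac{v_1'v_0'}{v_1v_0}+\frac{v_{-1}'v_0'}{v_{-1}v_0}+3(p-a)\left(\frac{v_{-1}'}{v_0}-\frac{v_1'v_0}{v_1^2}\right)+(\alpha_2+3a)\left(\frac{v_{-1}'}{v_{-1}}-\frac{v_1'}{v_1}\right)$$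 $$-\left(\frac{v_1}{v_0}-\frac{v_0}{v_{-1}}\right)\frac{P}{a-p}-\left(\frac{v_{-1}}{v_0}-\frac{v_0}{v_1}\right)(\alpha_2+3a)(a-p)+\left(\frac{v_{-1}^2}{v_0^2}-\frac{v_0^2}{v_1^2}\right)(a-p)^2,$$ where all functions are evaluated at $\xi$.
   Context: Primes denote derivatives with respect to $\xi$. $E=0$ is the one-component equation (in the variable $x$) of the A2 lattice system, on a $3\times3$ stencil centred at the origin; the vanishing of the limit is its straight semi-continuous limit. *)

theory Defs
  imports "HOL-Analysis.Analysis"
begin

definition smooth :: "(real \<Rightarrow> real) \<Rightarrow> bool" where
  "smooth f \<longleftrightarrow> (\<forall>n t. (deriv ^^ n) f field_differentiable at t)"

definition g3 :: "real \<Rightarrow> real \<Rightarrow> real \<Rightarrow> real \<Rightarrow> real" where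
  "g3 \<alpha>\<^sub>0 \<alpha>\<^sub>1 \<alpha>\<^sub>2 s = s ^ 3 + \<alpha>\<^sub>2 * s ^ 2 + \<alpha>\<^sub>1 * s + \<alpha>\<^sub>0"

(* One-component A2 equation E = 0; only the values of x at the stencil sites
   {-1,0,1} x {-1,0,1} are used. *)
definition A2_expr :: "real \<Rightarrow> real \<Rightarrow> (int \<Rightarrow> int \<Rightarrow> real) \<Rightarrow> real" where
  "A2_expr P Q x =
     ((P * x 0 0 - Q * x (-1) 1) / (x (-1) 1 - x 0 0)) * (x 0 1 / x (-1) 0)
   - ((P * x 1 (-1) - Q * x 0 0) / (x 0 0 - x 1 (-1))) * (x 1 0 / x 0 (-1))
   - (x (-1) (-1) / x 0 (-1) - x (-1) (-1) / x (-1) 0 - x 0 1 / x 1 1 + x 1 0 / x 1 1)"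

(* The straight limit: the second lattice direction becomes continuous, with \<epsilon> = 1/q. *)
definition x_straight ::
    "(int \<Rightarrow> real \<Rightarrow> real) \<Rightarrow> real \<Rightarrow> real \<Rightarrow> real \<Rightarrow> real \<Rightarrow> int \<Rightarrow> int \<Rightarrow> real" where
  "x_straight v p a \<xi> q \<nu> \<mu> =
     (p - a) powi (- \<nu>) * (q - a) powi (- \<mu>) * v \<nu> (\<xi> + (1 / q) * of_int \<mu>)"

definition straight_limit ::
    "real \<Rightarrow> real \<Rightarrow> real \<Rightarrow> real \<Rightarrow> (real \<Rightarrow> real) \<Rightarrow> (real \<Rightarrow> real) \<Rightarrow> (real \<Rightarrow> real) \<Rightarrow> real \<Rightarrow> real" where
  "straight_limit \<alpha>\<^sub>2 p a P vm vz vp \<xi> =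
     deriv (deriv vp) \<xi> / vp \<xi> + deriv (deriv vz) \<xi> / vz \<xi> + deriv (deriv vm) \<xi> / vm \<xi>
   - 2 * (deriv vp \<xi> / vp \<xi>) ^ 2 - (deriv vz \<xi> / vz \<xi>) ^ 2
   - (deriv vp \<xi> * deriv vz \<xi>) / (vp \<xi> * vz \<xi>)
   + (deriv vm \<xi> * deriv vz \<xi>) / (vm \<xi> * vz \<xi>)
   + 3 * (p - a) * (deriv vm \<xi> / vz \<xi> - deriv vp \<xi> * vz \<xi> / (vp \<xi>) ^ 2)
   + (\<alpha>\<^sub>2 + 3 * a) * (deriv vm \<xi> / vm \<xi> - deriv vp \<xi> / vp \<xi>)
   - (vp \<xi> / vz \<xi> - vz \<xi> / vm \<xi>) * (P / (a - p))
   - (vm \<xi> / vz \<xi> - vz \<xi> / vp \<xi>) * (\<alpha>\<^sub>2 + 3 * a) * (a - p)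
   + ((vm \<xi>) ^ 2 / (vz \<xi>) ^ 2 - (vz \<xi>) ^ 2 / (vp \<xi>) ^ 2) * (a - p) ^ 2"

end

(* Put h = 1/q and normalise M(h) = v_{-1}(xi + h)/v_{-1}(xi), and likewise Z, W for v_0, v_1.
   The factor q - a = (1 - a h)/h divides Q, so after clearing powers of h the quantity q E is
   N(h)/h^2 + R(h): R collects the terms with P and has an evident limit, and N is built by field
   operations from functions with a second-order Taylor expansion at 0.  In such expansions the
   coefficients of order 0 and 1 of N cancel, and the one of order 2 is the rest of the limit. *)

theory Submission
  imports Defs
begin

section \<open>Second-order expansions at 0 and their algebra\<close>

text \<open>Peano form of \<open>f h = a + b * h + c * h^2 + o(h^2)\<close>: \<open>c\<close> is the
  Taylor coefficient, half of a second derivative. The limit is two-sided and punctured, so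
  \<open>h\<close> may be replaced by \<open>- h\<close>, and \<open>f 0\<close> is left
  free.\<close>

definition jet2 :: "(real \<Rightarrow> real) \<Rightarrow> real \<Rightarrow> real \<Rightarrow> real \<Rightarrow> bool" where
  "jet2 f a b c \<longleftrightarrow> ((\<lambda>h. (f h - a - b * h) / h\<^sup>2) \<longlongrightarrow> c) (at 0)"

lemma jet2_const: "jet2 (\<lambda>_. a) a 0 0"
  by (simp add: jet2_def)

lemma jet2_ident: "jet2 (\<lambda>h. h) 0 1 0"
  by (simp add: jet2_def)

lemma jet2_add:
  assumes "jet2 f a b c" "jet2 g a' b' c'"
  shows "jet2 (\<lambda>h. f h + g h) (a + a') (b + b') (c + c')"
  using tendsto_add[OF assms[unfolded jet2_def]]
  unfolding jet2_def by (simp add: add_divide_distrib[symmetric] algebra_simps)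

lemma jet2_mult:
  assumes "jet2 f a b c" "jet2 g a' b' c'"
  shows "jet2 (\<lambda>h. f h * g h) (a * a') (a * b' + b * a') (a * c' + b * b' + c * a')"
proof -
  define F where "F h = (f h - a - b * h) / h\<^sup>2" for h
  define G where "G h = (g h - a' - b' * h) / h\<^sup>2" for h
  have F: "(F \<longlongrightarrow> c) (at 0)" and G: "(G \<longlongrightarrow> c') (at 0)"
    using assms by (simp_all add: jet2_def F_def[abs_def] G_def[abs_def])
  \<comment> \<open>With \<open>F\<close> and \<open>G\<close> the second-order quotients of the
    factors, that of the product is exactly this polynomial; every term beyond the first three
    carries a factor \<open>h\<close>.\<close>
  have "((\<lambda>h. a * G h + b * b' + F h * a' + h * (b * G h + b' * F h) + h\<^sup>2 * F h * G h)
      \<longlongrightarrow> a * c' + b * b' + c * a' + 0 * (b * c' + b' * c) + 0\<^sup>2 * c * c') (at 0)"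
    by (intro tendsto_intros F G)
  moreover have "\<forall>\<^sub>F h in at 0. a * G h + b * b' + F h * a' + h * (b * G h + b' * F h) + h\<^sup>2 * F h * G h
      = (f h * g h - a * a' - (a * b' + b * a') * h) / h\<^sup>2"
  proof (rule eventually_at_filter[THEN iffD2], rule always_eventually, intro allI impI)
    fix h :: real
    assume "h \<noteq> 0"
    then have f: "f h = a + b * h + F h * h\<^sup>2" and g: "g h = a' + b' * h + G h * h\<^sup>2"
      by (simp_all add: F_def G_def)
    show "a * G h + b * b' + F h * a' + h * (b * G h + b' * F h) + h\<^sup>2 * F h * G h
        = (f h * g h - a * a' - (a * b' + b * a') * h) / h\<^sup>2"
      unfolding f g using \<open>h \<noteq> 0\<close> by (simp add: field_simps power2_eq_square)
  qed
  ultimately show ?thesis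
    unfolding jet2_def by (simp add: Lim_transform_eventually)
qed

lemma jet2_cmult: "jet2 f a b c \<Longrightarrow> jet2 (\<lambda>h. k * f h) (k * a) (k * b) (k * c)"
  using jet2_mult[OF jet2_const, of f a b c k] by simp

lemma jet2_diff:
  assumes "jet2 f a b c" "jet2 g a' b' c'"
  shows "jet2 (\<lambda>h. f h - g h) (a - a') (b - b') (c - c')"
  using jet2_add[OF assms(1) jet2_cmult[OF assms(2), of "-1"]] by simp

lemma jet2_tendsto:
  assumes "jet2 f a b c"
  shows "(f \<longlongrightarrow> a) (at 0)"
proof -
  have "((\<lambda>h. a + b * h + (f h - a - b * h) / h\<^sup>2 * h\<^sup>2) \<longlongrightarrow> a + b * 0 + c * 0\<^sup>2) (at 0)"
    using assms unfolding jet2_def by (intro tendsto_intros)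
  moreover have "\<forall>\<^sub>F h in at 0. a + b * h + (f h - a - b * h) / h\<^sup>2 * h\<^sup>2 = f h"
    by (simp add: eventually_at_filter)
  ultimately show ?thesis
    by (simp add: Lim_transform_eventually)
qed

text \<open>With \<open>l\<close> the expected linear part,
  \<open>1 / f - l = (1 - l * f) / f\<close>. By the product rule \<open>1 - l * f\<close> starts at
  order 2, and its coefficient is then divided by \<open>a\<close>, the limit of
  \<open>f\<close>.\<close>

lemma jet2_inverse:
  assumes f: "jet2 f a b c" and "a \<noteq> 0"
  shows "jet2 (\<lambda>h. inverse (f h)) (1 / a) (- b / a\<^sup>2) (b\<^sup>2 / a ^ 3 - c / a\<^sup>2)"
proof -
  define l where "l h = 1 / a + (- b / a\<^sup>2) * h" for h
  have "jet2 l (1 / a + (- b / a\<^sup>2) * 0) (0 + (- b / a\<^sup>2) * 1) (0 + (- b / a\<^sup>2) * 0)"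
    unfolding l_def by (intro jet2_add jet2_cmult jet2_const jet2_ident)
  from jet2_diff[OF jet2_const[of 1] jet2_mult[OF this f]] \<open>a \<noteq> 0\<close>
  have "jet2 (\<lambda>h. 1 - l h * f h) 0 0 (b\<^sup>2 / a\<^sup>2 - c / a)"
    by (simp add: power2_eq_square)
  then have "((\<lambda>h. (1 - l h * f h) / h\<^sup>2 / f h) \<longlongrightarrow> (b\<^sup>2 / a\<^sup>2 - c / a) / a) (at 0)"
    using jet2_tendsto[OF f] \<open>a \<noteq> 0\<close> unfolding jet2_def by (intro tendsto_divide) simp_all
  moreover have "\<forall>\<^sub>F h in at 0. (1 - l h * f h) / h\<^sup>2 / f h
      = (inverse (f h) - 1 / a - (- b / a\<^sup>2) * h) / h\<^sup>2"
    using tendsto_imp_eventually_ne[OF jet2_tendsto[OF f] \<open>a \<noteq> 0\<close>]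
    by eventually_elim (simp add: l_def divide_simps, simp add: algebra_simps)
  ultimately show ?thesis
    unfolding jet2_def using \<open>a \<noteq> 0\<close>
    by (simp add: Lim_transform_eventually diff_divide_distrib power2_eq_square power3_eq_cube)
qed

lemma jet2_divide:
  assumes "jet2 f a b c" "jet2 g a' b' c'" "a' \<noteq> 0"
  shows "jet2 (\<lambda>h. f h / g h) (a / a') (b / a' - a * b' / a'\<^sup>2)
    (c / a' - b * b' / a'\<^sup>2 + a * (b'\<^sup>2 / a' ^ 3 - c' / a'\<^sup>2))"
  using jet2_mult[OF assms(1) jet2_inverse[OF assms(2,3)]] by (simp add: divide_inverse algebra_simps)

text \<open>Stencil sites with \<mu> = -1 evaluate their function at \<open>\<xi> - h\<close>.
  Negation preserves the punctured neighbourhoods of 0 and flips only the linear term.\<close>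

lemma jet2_reflect:
  assumes "jet2 f a b c"
  shows "jet2 (\<lambda>h. f (- h)) a (- b) c"
proof -
  have "filterlim uminus (at (0::real)) (at 0)"
    using filterlim_at_withinI[OF tendsto_minus[OF tendsto_ident_at[of "0::real" UNIV]], of UNIV]
    by (simp add: eventually_at_filter)
  from filterlim_compose[OF assms[unfolded jet2_def] this] show ?thesis
    by (simp add: jet2_def)
qed

text \<open>Taylor's formula with Lagrange remainder puts the second derivative at a point between
  \<open>x\<close> and \<open>x + h\<close>; its continuity brings that point to
  \<open>x\<close>.\<close>

lemma jet2_smooth:
  assumes "smooth f"
  shows "jet2 (\<lambda>h. f (x + h)) (f x) (deriv f x) (deriv (deriv f) x / 2)"
proof -
  have fd: "((deriv ^^ n) f has_field_derivative (deriv ^^ Suc n) f t) (at t)" for n t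
    using assms by (simp add: smooth_def field_differentiable_derivI)
  have "isCont (deriv (deriv f)) x"
    using fd[of 2] by (auto simp: numeral_2_eq_2 intro: DERIV_isCont)
  show ?thesis
    unfolding jet2_def LIM_eq
  proof (intro allI impI)
    fix e :: real
    assume "e > 0"
    with \<open>isCont (deriv (deriv f)) x\<close> obtain d where "d > 0"
      and d: "\<And>t. \<bar>t - x\<bar> < d \<Longrightarrow> \<bar>deriv (deriv f) t - deriv (deriv f) x\<bar> < e"
      unfolding continuous_at_eps_delta dist_real_def by metis
    show "\<exists>s>0. \<forall>h. h \<noteq> 0 \<and> norm (h - 0) < s \<longrightarrow>
      norm ((f (x + h) - f x - deriv f x * h) / h\<^sup>2 - deriv (deriv f) x / 2) < e"
    proof (intro exI[of _ d] conjI allI impI \<open>d > 0\<close>)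
      fix h :: real
      assume h: "h \<noteq> 0 \<and> norm (h - 0) < d"
      \<comment> \<open>The interval for Taylor's formula is symmetric about \<open>x\<close>, so
        that it serves both signs of \<open>h\<close>.\<close>
      have "\<exists>t. (if x + h < x then x + h < t \<and> t < x else x < t \<and> t < x + h) \<and>
        f (x + h) = (\<Sum>m<2. (deriv ^^ m) f x / fact m * (x + h - x) ^ m)
          + (deriv ^^ 2) f t / fact 2 * (x + h - x) ^ 2"
        using h fd
        by (intro Taylor[where a = "x - \<bar>h\<bar>" and b = "x + \<bar>h\<bar>"]) auto
      then obtain t where t': "if x + h < x then x + h < t \<and> t < x else x < t \<and> t < x + h"
        and eq': "f (x + h) = (\<Sum>m<2. (deriv ^^ m) f x / fact m * (x + h - x) ^ m)
          + (deriv ^^ 2) f t / fact 2 * (x + h - x) ^ 2"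
        by blast
      from t' have t: "\<bar>t - x\<bar> < \<bar>h\<bar>"
        by (auto split: if_splits)
      from eq' have eq: "f (x + h) = f x + deriv f x * h + deriv (deriv f) t / 2 * h\<^sup>2"
        by (simp add: numeral_2_eq_2)
      have "(f (x + h) - f x - deriv f x * h) / h\<^sup>2 - deriv (deriv f) x / 2
          = (deriv (deriv f) t - deriv (deriv f) x) / 2"
        unfolding eq using h by (simp add: field_simps)
      moreover have "\<bar>deriv (deriv f) t - deriv (deriv f) x\<bar> < e"
        using d t h by auto
      ultimately show "norm ((f (x + h) - f x - deriv f x * h) / h\<^sup>2 - deriv (deriv f) x / 2) < e"
        by (simp only: real_norm_def) (simp add: abs_divide)
    qed
  qed
qed

lemma jet2_cong:
  "jet2 f a b c \<Longrightarrow> a = a' \<Longrightarrow> b = b' \<Longrightarrow> c = c' \<Longrightarrow> jet2 f a' b' c'"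
  by simp

section \<open>Expansion of the terms free of \<open>P\<close>\<close>

text \<open>At order 0 both quotients give 1 and the final bracket gives \<open>-1 + 1\<close>. At
  order 1 the difference of the quotients and the bracket share the coefficient
  \<open>m\<^sub>1 - w\<^sub>1 + \<beta> - \<gamma>\<close>. At order 2 this sum returns with the
  factor \<open>c + a\<close> from \<open>K * \<sigma>\<close>, and once more with \<open>a\<close>
  from the other \<open>\<sigma>\<close> and the factors \<open>1 - a * h\<close>. As
  \<open>K\<close> multiplies a difference of order \<open>h\<close>, \<open>d\<close> enters only
  at order 3.\<close>

lemma straight_bracket_limit:
  fixes a c d \<beta> \<gamma> :: real
  defines "\<sigma> \<equiv> \<lambda>h. inverse (1 - a * h)"
  defines "K \<equiv> \<lambda>h. 1 + c * h + d * (h * h)"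
  assumes M: "jet2 M 1 m\<^sub>1 m\<^sub>2" and Z: "jet2 Z 1 z\<^sub>1 z\<^sub>2" and W: "jet2 W 1 w\<^sub>1 w\<^sub>2"
  shows "((\<lambda>h. (K h * \<sigma> h * (M h * Z h / (1 - \<beta> * (h * \<sigma> h * M h)))
        - K h * \<sigma> h * (1 / (Z (- h) * (W (- h) - \<gamma> * (h * \<sigma> h))))
        - (\<beta> * (h * (M (- h) / Z (- h))) - (1 - a * h) * M (- h)
          - \<gamma> * (h * (Z h / W h)) + (1 - a * h) * (1 / W h))) / h\<^sup>2)
    \<longlongrightarrow> 2 * (w\<^sub>2 + z\<^sub>2 + m\<^sub>2) - 2 * w\<^sub>1\<^sup>2 - z\<^sub>1\<^sup>2 - w\<^sub>1 * z\<^sub>1 + m\<^sub>1 * z\<^sub>1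
      + 3 * (\<beta> * m\<^sub>1 - \<gamma> * w\<^sub>1) + (c + 2 * a) * (m\<^sub>1 - w\<^sub>1 + \<beta> - \<gamma>) + \<beta>\<^sup>2 - \<gamma>\<^sup>2) (at 0)"
    (is "((\<lambda>h. ?N h / h\<^sup>2) \<longlongrightarrow> ?L) _")
proof -
  have \<rho>: "jet2 (\<lambda>h. 1 - a * h) 1 (- a) 0"
    using jet2_diff[OF jet2_const jet2_cmult[OF jet2_ident], of 1 a] by simp
  have \<sigma>: "jet2 \<sigma> 1 a (a\<^sup>2)"
    using jet2_inverse[OF \<rho>] by (simp add: \<sigma>_def)
  have K: "jet2 K 1 c d"
    using jet2_add[OF jet2_add[OF jet2_const jet2_cmult[OF jet2_ident]]
        jet2_cmult[OF jet2_mult[OF jet2_ident jet2_ident]], of 1 c d]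
    by (simp add: K_def)
  note M' = jet2_reflect[OF M] and Z' = jet2_reflect[OF Z] and W' = jet2_reflect[OF W]
  note K\<sigma> = jet2_mult[OF K \<sigma>] and h\<sigma> = jet2_mult[OF jet2_ident \<sigma>]
  \<comment> \<open>\<open>A\<close> and \<open>B\<close> expand the two quotients;
    \<open>C\<close>, \<open>D\<close>, \<open>E\<close> and the product of \<open>1 - a * h\<close>
    with \<open>M (- h)\<close> make up the bracket.\<close>
  note A = jet2_mult[OF K\<sigma> jet2_divide[OF jet2_mult[OF M Z]
        jet2_diff[OF jet2_const jet2_cmult[OF jet2_mult[OF h\<sigma> M]]]], of 1 \<beta>]
  note B = jet2_mult[OF K\<sigma> jet2_divide[OF jet2_const
        jet2_mult[OF Z' jet2_diff[OF W' jet2_cmult[OF h\<sigma>]]]], of \<gamma> 1]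
  note C = jet2_cmult[OF jet2_mult[OF jet2_ident jet2_divide[OF M' Z']], of \<beta>]
  note D = jet2_cmult[OF jet2_mult[OF jet2_ident jet2_divide[OF Z W]], of \<gamma>]
  note E = jet2_mult[OF \<rho> jet2_divide[OF jet2_const W], of 1]
  have "jet2 ?N 0 0 ?L"
    \<comment> \<open>Every denominator has constant term 1, which settles the side conditions of
      division; the rest are polynomial identities between coefficients.\<close>
    by (rule jet2_cong[OF jet2_diff[OF jet2_diff[OF A B]
            jet2_add[OF jet2_diff[OF jet2_diff[OF C jet2_mult[OF \<rho> M']] D] E]]])
      (simp_all add: algebra_simps power2_eq_square power3_eq_cube)
  then show ?thesis
    by (simp add: jet2_def)
qed

section \<open>The limit of \<open>q * E\<close>\<close>

theorem mainTheorem8: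
  fixes \<alpha>\<^sub>0 \<alpha>\<^sub>1 \<alpha>\<^sub>2 p a \<xi> :: real
    and v :: "int \<Rightarrow> real \<Rightarrow> real"
  assumes "p \<noteq> a"
    and "\<And>\<nu>. \<nu> \<in> {-1, 0, 1} \<Longrightarrow> smooth (v \<nu>)"
    and "\<And>\<nu> t. \<nu> \<in> {-1, 0, 1} \<Longrightarrow> v \<nu> t \<noteq> 0"
  shows "((\<lambda>q. q * A2_expr
              (g3 \<alpha>\<^sub>0 \<alpha>\<^sub>1 \<alpha>\<^sub>2 p - g3 \<alpha>\<^sub>0 \<alpha>\<^sub>1 \<alpha>\<^sub>2 a)
              (g3 \<alpha>\<^sub>0 \<alpha>\<^sub>1 \<alpha>\<^sub>2 q - g3 \<alpha>\<^sub>0 \<alpha>\<^sub>1 \<alpha>\<^sub>2 a)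
              (x_straight v p a \<xi> q))
          \<longlongrightarrow> straight_limit \<alpha>\<^sub>2 p a (g3 \<alpha>\<^sub>0 \<alpha>\<^sub>1 \<alpha>\<^sub>2 p - g3 \<alpha>\<^sub>0 \<alpha>\<^sub>1 \<alpha>\<^sub>2 a)
                (v (-1)) (v 0) (v 1) \<xi>) at_top"
proof -
  define m z w where "m = v (-1) \<xi>" and "z = v 0 \<xi>" and "w = v 1 \<xi>"
  have nz: "m \<noteq> 0" "z \<noteq> 0" "w \<noteq> 0"
    using assms(3) by (simp_all add: m_def z_def w_def)
  define m\<^sub>1 z\<^sub>1 w\<^sub>1 where "m\<^sub>1 = deriv (v (-1)) \<xi>"
    and "z\<^sub>1 = deriv (v 0) \<xi>" and "w\<^sub>1 = deriv (v 1) \<xi>"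
  define m\<^sub>2 z\<^sub>2 w\<^sub>2 where "m\<^sub>2 = deriv (deriv (v (-1))) \<xi>"
    and "z\<^sub>2 = deriv (deriv (v 0)) \<xi>" and "w\<^sub>2 = deriv (deriv (v 1)) \<xi>"
  define b where "b = p - a"
  have "b \<noteq> 0"
    using assms(1) by (simp add: b_def)
  \<comment> \<open>With \<open>r = q - a\<close>, the ratio of \<open>x (-1) 1\<close> to
    \<open>x 0 0\<close> is \<open>\<beta> * M h / r\<close>, and that of \<open>x 0 0\<close> to
    \<open>x 1 (-1)\<close> is \<open>\<gamma> / (r * W (- h))\<close>. Both tend to 0, so neither
    difference in a denominator of \<open>E\<close> vanishes for large \<open>q\<close>.\<close>
  define \<beta> \<gamma> where "\<beta> = b * m / z" and "\<gamma> = b * z / w"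
  define M Z W where "M h = 1 / m * v (-1) (\<xi> + h)" and "Z h = 1 / z * v 0 (\<xi> + h)"
    and "W h = 1 / w * v 1 (\<xi> + h)" for h
  \<comment> \<open>For \<open>h = 1 / q\<close>, \<open>\<sigma> h\<close> is
    \<open>q / (q - a)\<close>. Dividing \<open>Q\<close> by \<open>q - a\<close> leaves
    \<open>q^2 + c * q + d\<close>, that is \<open>K h / h^2\<close>.\<close>
  define \<sigma> where "\<sigma> h = inverse (1 - a * h)" for h
  define c d where "c = a + \<alpha>\<^sub>2" and "d = a\<^sup>2 + \<alpha>\<^sub>2 * a + \<alpha>\<^sub>1"
  define K where "K h = 1 + c * h + d * (h * h)" for h
  define P where "P = g3 \<alpha>\<^sub>0 \<alpha>\<^sub>1 \<alpha>\<^sub>2 p - g3 \<alpha>\<^sub>0 \<alpha>\<^sub>1 \<alpha>\<^sub>2 a"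
  define N where "N h = K h * \<sigma> h * (M h * Z h / (1 - \<beta> * (h * \<sigma> h * M h)))
        - K h * \<sigma> h * (1 / (Z (- h) * (W (- h) - \<gamma> * (h * \<sigma> h))))
        - (\<beta> * (h * (M (- h) / Z (- h))) - (1 - a * h) * M (- h)
          - \<gamma> * (h * (Z h / W h)) + (1 - a * h) * (1 / W h))" for h
  define R where "R h = P * w / (b * z) * (\<sigma> h * W (- h) / (Z (- h) * (W (- h) - \<gamma> * (h * \<sigma> h))))
        - P * z / (b * m) * (\<sigma> h * Z h / (1 - \<beta> * (h * \<sigma> h * M h)))" for h

  have M: "jet2 M 1 (m\<^sub>1 / m) (m\<^sub>2 / m / 2)"
    using jet2_cmult[OF jet2_smooth[of "v (-1)" \<xi>], of "1 / m"] assms(2) nz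
    by (simp add: M_def[abs_def] m_def m\<^sub>1_def m\<^sub>2_def)
  have Z: "jet2 Z 1 (z\<^sub>1 / z) (z\<^sub>2 / z / 2)"
    using jet2_cmult[OF jet2_smooth[of "v 0" \<xi>], of "1 / z"] assms(2) nz
    by (simp add: Z_def[abs_def] z_def z\<^sub>1_def z\<^sub>2_def)
  have W: "jet2 W 1 (w\<^sub>1 / w) (w\<^sub>2 / w / 2)"
    using jet2_cmult[OF jet2_smooth[of "v 1" \<xi>], of "1 / w"] assms(2) nz
    by (simp add: W_def[abs_def] w_def w\<^sub>1_def w\<^sub>2_def)
  note lims = jet2_tendsto[OF M] jet2_tendsto[OF Z] jet2_tendsto[OF W]
    jet2_tendsto[OF jet2_reflect[OF Z]] jet2_tendsto[OF jet2_reflect[OF W]]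
  have \<rho>: "((\<lambda>h. 1 - a * h) \<longlongrightarrow> 1 - a * 0) (at 0)"
    by (intro tendsto_intros)
  have \<sigma>: "(\<sigma> \<longlongrightarrow> 1) (at 0)"
    unfolding \<sigma>_def[abs_def] using tendsto_inverse[OF \<rho>] by simp
  have D1: "((\<lambda>h. 1 - \<beta> * (h * \<sigma> h * M h)) \<longlongrightarrow> 1 - \<beta> * (0 * 1 * 1)) (at 0)"
    by (intro tendsto_intros lims \<sigma>)
  have D2: "((\<lambda>h. W (- h) - \<gamma> * (h * \<sigma> h)) \<longlongrightarrow> 1 - \<gamma> * (0 * 1)) (at 0)"
    by (intro tendsto_intros lims \<sigma>)
  have "(R \<longlongrightarrow> P * w / (b * z) * (1 * 1 / (1 * (1 - \<gamma> * (0 * 1))))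
        - P * z / (b * m) * (1 * 1 / (1 - \<beta> * (0 * 1 * 1)))) (at 0)"
    unfolding R_def[abs_def] by (intro tendsto_intros lims \<sigma> D1 D2) simp_all
  then have R: "(R \<longlongrightarrow> P * w / (b * z) - P * z / (b * m)) (at 0)"
    by simp
  have N: "((\<lambda>h. N h / h\<^sup>2) \<longlongrightarrow>
        2 * (w\<^sub>2 / w / 2 + z\<^sub>2 / z / 2 + m\<^sub>2 / m / 2)
        - 2 * (w\<^sub>1 / w)\<^sup>2 - (z\<^sub>1 / z)\<^sup>2 - w\<^sub>1 / w * (z\<^sub>1 / z) + m\<^sub>1 / m * (z\<^sub>1 / z)
        + 3 * (\<beta> * (m\<^sub>1 / m) - \<gamma> * (w\<^sub>1 / w))
        + (c + 2 * a) * (m\<^sub>1 / m - w\<^sub>1 / w + \<beta> - \<gamma>) + \<beta>\<^sup>2 - \<gamma>\<^sup>2) (at 0)"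
    (is "(_ \<longlongrightarrow> ?L) _")
    unfolding N_def K_def \<sigma>_def by (rule straight_bracket_limit[OF M Z W])
  have lim: "((\<lambda>h. N h / h\<^sup>2 + R h) \<longlongrightarrow> straight_limit \<alpha>\<^sub>2 p a P (v (-1)) (v 0) (v 1) \<xi>) (at 0)"
  proof (rule tendsto_eq_rhs[OF tendsto_add[OF N R]])
    \<comment> \<open>The translation to the stated limit: the factor 2 undoes the halves of the
      second derivatives, \<open>c + 2 * a\<close> is \<open>\<alpha>\<^sub>2 + 3 * a\<close>, and
      \<open>\<beta> - \<gamma>\<close> is \<open>b * (m / z - z / w)\<close>.\<close>
    have ap: "a - p = - b"
      by (simp add: b_def)
    have 1: "2 * (w\<^sub>2 / w / 2 + z\<^sub>2 / z / 2 + m\<^sub>2 / m / 2) = w\<^sub>2 / w + z\<^sub>2 / z + m\<^sub>2 / m"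
      by simp
    have 2: "\<beta> * (m\<^sub>1 / m) - \<gamma> * (w\<^sub>1 / w) = b * (m\<^sub>1 / z - w\<^sub>1 * z / w\<^sup>2)"
      using nz by (simp add: \<beta>_def \<gamma>_def field_simps power2_eq_square)
    have 3: "(c + 2 * a) * (m\<^sub>1 / m - w\<^sub>1 / w + \<beta> - \<gamma>)
        = (\<alpha>\<^sub>2 + 3 * a) * (m\<^sub>1 / m - w\<^sub>1 / w) - (m / z - z / w) * (\<alpha>\<^sub>2 + 3 * a) * (- b)"
      by (simp add: \<beta>_def \<gamma>_def c_def algebra_simps)
    have 4: "\<beta>\<^sup>2 - \<gamma>\<^sup>2 = (m\<^sup>2 / z\<^sup>2 - z\<^sup>2 / w\<^sup>2) * (- b)\<^sup>2"
      by (simp add: \<beta>_def \<gamma>_def power_divide power_mult_distrib algebra_simps)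
    have 5: "P * w / (b * z) - P * z / (b * m) = - (w / z - z / m) * (P / (- b))"
      using nz \<open>b \<noteq> 0\<close> by (simp add: field_simps)
    have 6: "w\<^sub>1 / w * (z\<^sub>1 / z) = w\<^sub>1 * z\<^sub>1 / (w * z)" "m\<^sub>1 / m * (z\<^sub>1 / z) = m\<^sub>1 * z\<^sub>1 / (m * z)"
      by simp_all
    show "?L + (P * w / (b * z) - P * z / (b * m))
        = straight_limit \<alpha>\<^sub>2 p a P (v (-1)) (v 0) (v 1) \<xi>"
      unfolding straight_limit_def ap m_def[symmetric] z_def[symmetric] w_def[symmetric]
        b_def[symmetric] m\<^sub>1_def[symmetric] z\<^sub>1_def[symmetric] w\<^sub>1_def[symmetric]
        m\<^sub>2_def[symmetric] z\<^sub>2_def[symmetric] w\<^sub>2_def[symmetric] 1 2 3 5 6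
      using 4 by linarith
  qed

  \<comment> \<open>This is an exact identity, valid for either sign of \<open>h\<close>; the four
    conditions hold near 0 and make all divisions legitimate.\<close>
  have E: "1 / h * A2_expr P (g3 \<alpha>\<^sub>0 \<alpha>\<^sub>1 \<alpha>\<^sub>2 (1 / h) - g3 \<alpha>\<^sub>0 \<alpha>\<^sub>1 \<alpha>\<^sub>2 a) (x_straight v p a \<xi> (1 / h))
      = N h / h\<^sup>2 + R h"
    if h: "h \<noteq> 0" "1 - a * h \<noteq> 0" "1 - \<beta> * (h * \<sigma> h * M h) \<noteq> 0" "W (- h) - \<gamma> * (h * \<sigma> h) \<noteq> 0" for h
  proof -
    define r where "r = 1 / h - a"
    have \<rho>: "1 - a * h = h * r"
      using h by (simp add: r_def field_simps)
    then have "r \<noteq> 0" and \<sigma>: "\<sigma> h = 1 / (h * r)"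
      using h by (auto simp: \<sigma>_def divide_inverse)
    have Q: "g3 \<alpha>\<^sub>0 \<alpha>\<^sub>1 \<alpha>\<^sub>2 (1 / h) - g3 \<alpha>\<^sub>0 \<alpha>\<^sub>1 \<alpha>\<^sub>2 a = r * K h / h\<^sup>2"
      using h by (simp add: r_def g3_def K_def c_def d_def field_simps power2_eq_square power3_eq_cube)
    have v: "v (-1) (\<xi> + t) = m * M t" "v 0 (\<xi> + t) = z * Z t" "v 1 (\<xi> + t) = w * W t" for t
      using nz by (simp_all add: M_def Z_def W_def)
    have one: "M 0 = 1" "Z 0 = 1" "W 0 = 1"
      using nz by (simp_all add: M_def Z_def W_def m_def z_def w_def)
    have x: "x_straight v p a \<xi> (1 / h) 0 0 = z"
      "x_straight v p a \<xi> (1 / h) (-1) 1 = b * m * M h / r"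
      "x_straight v p a \<xi> (1 / h) 0 1 = z * Z h / r"
      "x_straight v p a \<xi> (1 / h) (-1) 0 = b * m"
      "x_straight v p a \<xi> (1 / h) 1 (-1) = r * w * W (- h) / b"
      "x_straight v p a \<xi> (1 / h) 1 0 = w / b"
      "x_straight v p a \<xi> (1 / h) 0 (-1) = r * z * Z (- h)"
      "x_straight v p a \<xi> (1 / h) (-1) (-1) = b * r * m * M (- h)"
      "x_straight v p a \<xi> (1 / h) 1 1 = w * W h / (b * r)"
      unfolding x_straight_def b_def[symmetric] r_def[symmetric] v
      by (simp_all add: one power_int_minus divide_inverse)
    have ne: "M t \<noteq> 0" "Z t \<noteq> 0" "W t \<noteq> 0" for t
      using assms(3) nz by (simp_all add: M_def Z_def W_def)
    define D\<^sub>1 where "D\<^sub>1 = 1 - \<beta> * (h * \<sigma> h * M h)"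
    define D\<^sub>2 where "D\<^sub>2 = W (- h) - \<gamma> * (h * \<sigma> h)"
    have D: "D\<^sub>1 \<noteq> 0" "D\<^sub>2 \<noteq> 0"
      using h by (simp_all add: D\<^sub>1_def D\<^sub>2_def)
    \<comment> \<open>In both denominators the subtracted entry dominates. Its factor is pulled out
      with the minus sign, leaving \<open>D\<^sub>1\<close> and \<open>D\<^sub>2\<close>, which tend
      to 1.\<close>
    have den1: "b * m * M h / r - z = - (z * D\<^sub>1)"
      using nz h \<open>r \<noteq> 0\<close> by (simp add: D\<^sub>1_def \<sigma> \<beta>_def field_simps)
    have den2: "z - r * w * W (- h) / b = - (r * w * D\<^sub>2 / b)"
      using nz h \<open>r \<noteq> 0\<close> \<open>b \<noteq> 0\<close> by (simp add: D\<^sub>2_def \<sigma> \<gamma>_def field_simps)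
    \<comment> \<open>\<open>T1\<close>, \<open>T2\<close> and \<open>T3\<close> treat the three
      summands of \<open>E\<close>. The \<open>Q\<close> terms and the bracket end up over
      \<open>h^2\<close>, in \<open>N\<close>; the \<open>P\<close> terms stay bounded and form
      \<open>R\<close>.\<close>
    have T1: "1 / h * ((P * z - r * K h / h\<^sup>2 * (b * m * M h / r)) / - (z * D\<^sub>1) * (z * Z h / r / (b * m)))
        = K h * \<sigma> h * (M h * Z h / D\<^sub>1) / h\<^sup>2 - P * z / (b * m) * (\<sigma> h * Z h / D\<^sub>1)"
      unfolding \<sigma> using nz h(1) \<open>r \<noteq> 0\<close> \<open>b \<noteq> 0\<close> D by (simp add: field_simps power2_eq_square)
    have T2: "1 / h * ((P * (r * w * W (- h) / b) - r * K h / h\<^sup>2 * z) / - (r * w * D\<^sub>2 / b)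
          * (w / b / (r * z * Z (- h))))
        = K h * \<sigma> h * (1 / (Z (- h) * D\<^sub>2)) / h\<^sup>2 - P * w / (b * z) * (\<sigma> h * W (- h) / (Z (- h) * D\<^sub>2))"
      unfolding \<sigma> using nz h(1) ne \<open>r \<noteq> 0\<close> \<open>b \<noteq> 0\<close> D by (simp add: field_simps power2_eq_square)
    have T3: "1 / h * (b * r * m * M (- h) / (r * z * Z (- h)) - b * r * m * M (- h) / (b * m)
          - z * Z h / r / (w * W h / (b * r)) + w / b / (w * W h / (b * r)))
        = (\<beta> * (h * (M (- h) / Z (- h))) - h * r * M (- h) - \<gamma> * (h * (Z h / W h)) + h * r * (1 / W h)) / h\<^sup>2"
      unfolding \<beta>_def \<gamma>_def
      using nz h(1) ne \<open>r \<noteq> 0\<close> \<open>b \<noteq> 0\<close> by (simp add: field_simps power2_eq_square)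
    have distr: "1 / h * (A - B - C) = 1 / h * A - 1 / h * B - 1 / h * C" for A B C
      by (simp only: right_diff_distrib)
    show ?thesis
      unfolding A2_expr_def x Q den1 den2 distr T1 T2 T3 N_def R_def
        D\<^sub>1_def[symmetric] D\<^sub>2_def[symmetric] \<rho>
      by (simp add: diff_divide_distrib)
  qed
  have "\<forall>\<^sub>F h in at 0. N h / h\<^sup>2 + R h
      = 1 / h * A2_expr P (g3 \<alpha>\<^sub>0 \<alpha>\<^sub>1 \<alpha>\<^sub>2 (1 / h) - g3 \<alpha>\<^sub>0 \<alpha>\<^sub>1 \<alpha>\<^sub>2 a) (x_straight v p a \<xi> (1 / h))"
  proof -
    have "\<forall>\<^sub>F h in at (0::real). h \<noteq> 0"
      by (simp add: eventually_at_filter)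
    moreover have "\<forall>\<^sub>F h in at 0. 1 - a * h \<noteq> 0"
      by (rule tendsto_imp_eventually_ne[OF \<rho>]) simp
    moreover have "\<forall>\<^sub>F h in at 0. 1 - \<beta> * (h * \<sigma> h * M h) \<noteq> 0"
      by (rule tendsto_imp_eventually_ne[OF D1]) simp
    moreover have "\<forall>\<^sub>F h in at 0. W (- h) - \<gamma> * (h * \<sigma> h) \<noteq> 0"
      by (rule tendsto_imp_eventually_ne[OF D2]) simp
    ultimately show ?thesis
      by eventually_elim (rule E[symmetric])
  qed
  from Lim_transform_eventually[OF lim this]
  have "((\<lambda>h. 1 / h * A2_expr P (g3 \<alpha>\<^sub>0 \<alpha>\<^sub>1 \<alpha>\<^sub>2 (1 / h) - g3 \<alpha>\<^sub>0 \<alpha>\<^sub>1 \<alpha>\<^sub>2 a) (x_straight v p a \<xi> (1 / h)))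
      \<longlongrightarrow> straight_limit \<alpha>\<^sub>2 p a P (v (-1)) (v 0) (v 1) \<xi>) (at 0)" .
  \<comment> \<open>As \<open>q\<close> tends to infinity, \<open>h = 1 / q\<close> approaches 0
    from the right, a case of the two-sided limit.\<close>
  from filterlim_compose[OF this filterlim_mono[OF filterlim_inverse_at_right_top at_le order_refl]]
  show ?thesis
    by (simp add: P_def divide_inverse)
qed

end
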